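(* Let $L$ be a bounded distributive lattice and $B_L$ its free Boolean extension. Then $L^{\Diamond\Box}$ is (realized as) the sublattice of the powerset $\wp(B_L)$ generated by the sets $\Box_a={\downarrow}a$ and $\Diamond_b=({\downarrow}b')^c$, where $a,b$ range over all elements of $L$. That is, there is an isomorphism from $L^{\Diamond\Box}$ onto this sublattice sending the generator $\Box_a$ to ${\downarrow}a$ and the generator $\Diamond_b$ to $({\downarrow}b')^c$ for all $a,b\in L$.
   Context: $B_L$ is the free Boolean extension of $L$: the Boolean algebra containing $L$ as a bounded sublattice and generated by $L$ (unique up to isomorphism over $L$). For $b\in L$, $b'$ is the complement of $b$ in $B_L$; for $c\in B_L$, ${\downarrow}c=\{u\in B_L\mid u\le c\}$; $(\cdot)^c$ is set complement in $B_L$; $\wp(B_L)$ is a lattice under union and intersection. $L^{\Diamond\Box}$ is the bounded distributive lattice freely generated by the set of symbols $\Diamond_a,\Box_a$ for $a\in L$ modulo the relations (for all $a,b\in L$): $\Diamond_0=0$, $\Diamond_a\vee\Diamond_b=\Diamond_{a\vee b}$, $\Box_1=1$, $\Box_a\wedge\Box_b=\Box_{a\wedge b}$, $\Box_{a\vee b}\le\Box_a\vee\Diamond_b$, and $\Box_a\wedge\Diamond_b\le\Diamond_{a\wedge b}$. *)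

theory Defs
  imports Main
begin

definition bounded_lattice_hom ::
    "('a::bounded_lattice \<Rightarrow> 'b::bounded_lattice) \<Rightarrow> bool" where
  "bounded_lattice_hom f \<longleftrightarrow>
     f bot = bot \<and> f top = top \<and>
     (\<forall>x y. f (sup x y) = sup (f x) (f y)) \<and>
     (\<forall>x y. f (inf x y) = inf (f x) (f y))"

inductive_set generated_sublattice :: "'a::lattice set \<Rightarrow> 'a set" for G where
  base: "x \<in> G \<Longrightarrow> x \<in> generated_sublattice G"
| sup: "x \<in> generated_sublattice G \<Longrightarrow> y \<in> generated_sublattice G
    \<Longrightarrow> sup x y \<in> generated_sublattice G"
| inf: "x \<in> generated_sublattice G \<Longrightarrow> y \<in> generated_sublattice G
    \<Longrightarrow> inf x y \<in> generated_sublattice G"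

inductive_set generated_subalgebra :: "'a::boolean_algebra set \<Rightarrow> 'a set" for G where
  base: "x \<in> G \<Longrightarrow> x \<in> generated_subalgebra G"
| bot: "bot \<in> generated_subalgebra G"
| top: "top \<in> generated_subalgebra G"
| sup: "x \<in> generated_subalgebra G \<Longrightarrow> y \<in> generated_subalgebra G
    \<Longrightarrow> sup x y \<in> generated_subalgebra G"
| inf: "x \<in> generated_subalgebra G \<Longrightarrow> y \<in> generated_subalgebra G
    \<Longrightarrow> inf x y \<in> generated_subalgebra G"
| compl: "x \<in> generated_subalgebra G \<Longrightarrow> - x \<in> generated_subalgebra G"

text \<open>
  The type \<open>'b\<close> together with \<open>e\<close> is a free Boolean extension of the lattice \<open>'a\<close>: the
  embedding \<open>e\<close> identifies \<open>'a\<close> with a bounded sublattice of \<open>'b\<close> that generates \<open>'b\<close>.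
  Lattices with \<open>bot = top\<close> are allowed.
\<close>

definition free_boolean_extension ::
    "('a::{distrib_lattice,bounded_lattice} \<Rightarrow> 'b::boolean_algebra) \<Rightarrow> bool" where
  "free_boolean_extension e \<longleftrightarrow>
     bounded_lattice_hom e \<and> inj e \<and> generated_subalgebra (range e) = UNIV"

text \<open>
  The lattice presented by the generators \<open>Dia a\<close>, \<open>Box a\<close> and the relations below is the type
  of lattice terms over these symbols modulo the least congruence that contains the axioms of
  bounded distributive lattices and the relations.
\<close>

datatype 'a dbterm =
    BoxT 'a
  | DiaT 'a
  | BotT
  | TopT
  | SupT "'a dbterm" "'a dbterm"
  | InfT "'a dbterm" "'a dbterm"

inductive dbcong ::
    "'a::{distrib_lattice,bounded_lattice} dbterm \<Rightarrow> 'a dbterm \<Rightarrow> bool" where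
  refl: "dbcong s s"
| sym: "dbcong s t \<Longrightarrow> dbcong t s"
| trans: "dbcong s t \<Longrightarrow> dbcong t u \<Longrightarrow> dbcong s u"
| SupT_cong: "dbcong s s' \<Longrightarrow> dbcong t t' \<Longrightarrow> dbcong (SupT s t) (SupT s' t')"
| InfT_cong: "dbcong s s' \<Longrightarrow> dbcong t t' \<Longrightarrow> dbcong (InfT s t) (InfT s' t')"
| SupT_commute: "dbcong (SupT s t) (SupT t s)"
| InfT_commute: "dbcong (InfT s t) (InfT t s)"
| SupT_assoc: "dbcong (SupT (SupT s t) u) (SupT s (SupT t u))"
| InfT_assoc: "dbcong (InfT (InfT s t) u) (InfT s (InfT t u))"
| SupT_absorb: "dbcong (SupT s (InfT s t)) s"
| InfT_absorb: "dbcong (InfT s (SupT s t)) s"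
| distrib: "dbcong (SupT s (InfT t u)) (InfT (SupT s t) (SupT s u))"
| BotT: "dbcong (SupT BotT s) s"
| TopT: "dbcong (InfT TopT s) s"
| Dia_bot: "dbcong (DiaT bot) BotT"
| Dia_sup: "dbcong (SupT (DiaT a) (DiaT b)) (DiaT (sup a b))"
| Box_top: "dbcong (BoxT top) TopT"
| Box_inf: "dbcong (InfT (BoxT a) (BoxT b)) (BoxT (inf a b))"
  \<comment> \<open>an inequality \<open>s \<le> t\<close> is imposed as the equation \<open>s \<sqinter> t = s\<close>\<close>
| Box_sup: "dbcong (InfT (BoxT (sup a b)) (SupT (BoxT a) (DiaT b))) (BoxT (sup a b))"
| Box_Dia: "dbcong (InfT (InfT (BoxT a) (DiaT b)) (DiaT (inf a b))) (InfT (BoxT a) (DiaT b))"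

quotient_type (overloaded) 'a dblattice =
  "'a::{distrib_lattice,bounded_lattice} dbterm" / dbcong
  by (intro equivpI reflpI sympI transpI) (blast intro: dbcong.refl dbcong.sym dbcong.trans)+

lift_definition Box :: "'a::{distrib_lattice,bounded_lattice} \<Rightarrow> 'a dblattice" is BoxT .
lift_definition Dia :: "'a::{distrib_lattice,bounded_lattice} \<Rightarrow> 'a dblattice" is DiaT .

instantiation dblattice :: ("{distrib_lattice,bounded_lattice}") "{distrib_lattice,bounded_lattice}"
begin

lift_definition sup_dblattice :: "'a dblattice \<Rightarrow> 'a dblattice \<Rightarrow> 'a dblattice" is SupT
  by (rule dbcong.SupT_cong)
lift_definition inf_dblattice :: "'a dblattice \<Rightarrow> 'a dblattice \<Rightarrow> 'a dblattice" is InfT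
  by (rule dbcong.InfT_cong)
lift_definition bot_dblattice :: "'a dblattice" is BotT .
lift_definition top_dblattice :: "'a dblattice" is TopT .

definition less_eq_dblattice :: "'a dblattice \<Rightarrow> 'a dblattice \<Rightarrow> bool" where
  "less_eq_dblattice x y \<longleftrightarrow> inf x y = x"
definition less_dblattice :: "'a dblattice \<Rightarrow> 'a dblattice \<Rightarrow> bool" where
  "less_dblattice x y \<longleftrightarrow> x \<le> y \<and> \<not> y \<le> x"

instance
proof
  fix x y z :: "'a dblattice"
  have ic: "inf a b = inf b a" and sc: "sup a b = sup b a"
    and ia: "inf (inf a b) c = inf a (inf b c)" and sa: "sup (sup a b) c = sup a (sup b c)"
    and si: "sup a (inf a b) = a" and absi: "inf a (sup a b) = a" for a b c :: "'a dblattice"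
    by (transfer, rule dbcong.InfT_commute dbcong.SupT_commute dbcong.InfT_assoc
      dbcong.SupT_assoc dbcong.SupT_absorb dbcong.InfT_absorb)+
  have ii: "inf a a = a" for a :: "'a dblattice"
    using absi[of a "inf a a"] by (simp only: si)
  have le_sup: "a \<le> b \<longleftrightarrow> sup a b = b" for a b :: "'a dblattice"
    unfolding less_eq_dblattice_def
    using si[of b a] absi[of a b] by (auto simp only: ic[of b a] sc[of b])
  show "x < y \<longleftrightarrow> x \<le> y \<and> \<not> y \<le> x" by (rule less_dblattice_def)
  show "x \<le> x" by (simp add: less_eq_dblattice_def ii)
  show "x \<le> y \<Longrightarrow> y \<le> z \<Longrightarrow> x \<le> z"
    unfolding less_eq_dblattice_def using ia[of x y z] by simp
  show "x \<le> y \<Longrightarrow> y \<le> x \<Longrightarrow> x = y"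
    unfolding less_eq_dblattice_def using ic[of x y] by simp
  show "inf x y \<le> y" unfolding less_eq_dblattice_def by (simp only: ia ii)
  show "inf x y \<le> x" unfolding less_eq_dblattice_def by (simp only: ic[of x y] ia ii)
  show "x \<le> y \<Longrightarrow> x \<le> z \<Longrightarrow> x \<le> inf y z"
    unfolding less_eq_dblattice_def using ia[of x y z] by simp
  show "x \<le> sup x y" unfolding less_eq_dblattice_def by (rule absi)
  show "y \<le> sup x y" unfolding less_eq_dblattice_def sc[of x y] by (rule absi)
  show "y \<le> x \<Longrightarrow> z \<le> x \<Longrightarrow> sup y z \<le> x"
    unfolding le_sup using sa[of y z x] by simp
  have "sup bot x = x" by transfer (rule dbcong.BotT)
  then show "bot \<le> x" by (simp add: le_sup)
  have "inf top x = x" by transfer (rule dbcong.TopT)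
  then show "x \<le> top" by (simp add: less_eq_dblattice_def ic)
  show "sup x (inf y z) = inf (sup x y) (sup x z)" by transfer (rule dbcong.distrib)
qed

end

definition dbrelations ::
    "('a::{distrib_lattice,bounded_lattice} \<Rightarrow> 'c::{distrib_lattice,bounded_lattice})
      \<Rightarrow> ('a \<Rightarrow> 'c) \<Rightarrow> bool" where
  "dbrelations box dia \<longleftrightarrow>
     dia bot = bot \<and> (\<forall>a b. sup (dia a) (dia b) = dia (sup a b)) \<and>
     box top = top \<and> (\<forall>a b. inf (box a) (box b) = box (inf a b)) \<and>
     (\<forall>a b. box (sup a b) \<le> sup (box a) (dia b)) \<and>
     (\<forall>a b. inf (box a) (dia b) \<le> dia (inf a b))"

lemma dbrelations_Box_Dia: "dbrelations Box Dia"
  unfolding dbrelations_def less_eq_dblattice_def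
  by (intro conjI allI; transfer; rule dbcong.Dia_bot dbcong.Dia_sup dbcong.Box_top
    dbcong.Box_inf dbcong.Box_sup dbcong.Box_Dia)

primrec dbeval :: "('a \<Rightarrow> 'c::bounded_lattice) \<Rightarrow> ('a \<Rightarrow> 'c) \<Rightarrow> 'a dbterm \<Rightarrow> 'c" where
  "dbeval box dia (BoxT a) = box a"
| "dbeval box dia (DiaT a) = dia a"
| "dbeval box dia BotT = bot"
| "dbeval box dia TopT = top"
| "dbeval box dia (SupT s t) = sup (dbeval box dia s) (dbeval box dia t)"
| "dbeval box dia (InfT s t) = inf (dbeval box dia s) (dbeval box dia t)"

lemma dbeval_cong:
  assumes "dbrelations box dia" and "dbcong s t"
  shows "dbeval box dia s = dbeval box dia t"
  using assms(2,1)
proof induction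
  case (Box_Dia a b)
  then show ?case by (simp add: dbrelations_def inf_absorb1)
qed (auto simp: dbrelations_def ac_simps sup_inf_distrib1 inf_absorb1 inf_absorb2)

text \<open>The universal property of the presentation.\<close>

theorem dblattice_universal:
  fixes box dia ::
    "'a::{distrib_lattice,bounded_lattice} \<Rightarrow> 'c::{distrib_lattice,bounded_lattice}"
  assumes "dbrelations box dia"
  shows "\<exists>!h. bounded_lattice_hom h \<and> (\<forall>a. h (Box a) = box a) \<and> (\<forall>a. h (Dia a) = dia a)"
proof -
  define h where "h x = dbeval box dia (rep_dblattice x)" for x
  have h_abs: "h (abs_dblattice t) = dbeval box dia t" for t
    unfolding h_def
    by (rule dbeval_cong[OF assms])
      (metis Quotient3_rep_abs[OF Quotient3_dblattice] dbcong.refl)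
  have abs: "\<exists>t. x = abs_dblattice t" for x :: "'a dblattice"
    by (metis Quotient3_abs_rep[OF Quotient3_dblattice])
  have "bounded_lattice_hom h"
    unfolding bounded_lattice_hom_def
  proof (intro conjI allI)
    show "h bot = bot" by (simp add: bot_dblattice.abs_eq h_abs)
    show "h top = top" by (simp add: top_dblattice.abs_eq h_abs)
    fix x y :: "'a dblattice"
    obtain s t where "x = abs_dblattice s" "y = abs_dblattice t" using abs by metis
    then show "h (sup x y) = sup (h x) (h y)" "h (inf x y) = inf (h x) (h y)"
      by (simp_all add: sup_dblattice.abs_eq inf_dblattice.abs_eq h_abs)
  qed
  moreover have "h (Box a) = box a" "h (Dia a) = dia a" for a
    by (simp_all add: Box.abs_eq Dia.abs_eq h_abs)
  moreover have "k = h"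
    if k: "bounded_lattice_hom k" "\<forall>a. k (Box a) = box a" "\<forall>a. k (Dia a) = dia a" for k
  proof
    fix x :: "'a dblattice"
    obtain t where "x = abs_dblattice t" using abs by metis
    moreover have "k (abs_dblattice t) = dbeval box dia t"
      by (induction t)
        (use k in \<open>simp_all add: bounded_lattice_hom_def flip: Box.abs_eq Dia.abs_eq
          bot_dblattice.abs_eq top_dblattice.abs_eq sup_dblattice.abs_eq inf_dblattice.abs_eq\<close>)
    ultimately show "k x = h x" by (simp add: h_abs)
  qed
  ultimately show ?thesis by blast
qed

end

(* In a distributive lattice generated by G every element is a finite join of finite meets, and a
   finite meet of finite joins, of members of G. To embed the presented lattice it therefore
   suffices to reflect inequalities from a meet of generators, Box a and some Dia b, to a join of
   generators, Dia d and some Box c. If such an inequality holds for the sets, then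
   u = e a - e d, which lies in Box a but not in Dia d, either lies outside some Dia b or inside
   some Box c. That is, inf a b <= d or a <= sup c d in the lattice, and one of the two mixed
   relations of the presentation yields the inequality. *)

theory Submission
  imports Defs
begin

text \<open>These are the nonempty finite meets: a mere lattice has no top to serve as the empty
  meet.\<close>

inductive_set inf_closure :: "'a::lattice set \<Rightarrow> 'a set" for G where
  base: "x \<in> G \<Longrightarrow> x \<in> inf_closure G"
| inf: "x \<in> inf_closure G \<Longrightarrow> y \<in> inf_closure G \<Longrightarrow> inf x y \<in> inf_closure G"

inductive_set sup_closure :: "'a::lattice set \<Rightarrow> 'a set" for G where
  base: "x \<in> G \<Longrightarrow> x \<in> sup_closure G"
| sup: "x \<in> sup_closure G \<Longrightarrow> y \<in> sup_closure G \<Longrightarrow> sup x y \<in> sup_closure G"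

text \<open>Distributivity moves the meet inside the joins, first for \<open>x\<close>, then for
  \<open>y\<close> against a single joinand of \<open>x\<close>.\<close>

lemma inf_sup_closure_inf_closure:
  fixes G :: "'a::distrib_lattice set"
  assumes "x \<in> sup_closure (inf_closure G)" "y \<in> sup_closure (inf_closure G)"
  shows "inf x y \<in> sup_closure (inf_closure G)"
  using assms(1)
proof induction
  case (base x)
  from assms(2) show ?case
    by induction (use base in \<open>auto simp: inf_sup_distrib1
      intro: sup_closure.intros inf_closure.inf\<close>)
qed (simp add: inf_sup_distrib2 sup_closure.sup)

lemma sup_inf_closure_sup_closure:
  fixes G :: "'a::distrib_lattice set"
  assumes "x \<in> inf_closure (sup_closure G)" "y \<in> inf_closure (sup_closure G)"
  shows "sup x y \<in> inf_closure (sup_closure G)"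
  using assms(1)
proof induction
  case (base x)
  from assms(2) show ?case
    by induction (use base in \<open>auto simp: sup_inf_distrib1
      intro: inf_closure.intros sup_closure.sup\<close>)
qed (simp add: sup_inf_distrib2 inf_closure.inf)

lemma generated_sublattice_subset_sup_inf:
  fixes G :: "'a::distrib_lattice set"
  assumes "x \<in> generated_sublattice G"
  shows "x \<in> sup_closure (inf_closure G)"
  using assms
  by induction (auto intro: sup_closure.intros inf_closure.base inf_sup_closure_inf_closure)

lemma generated_sublattice_subset_inf_sup:
  fixes G :: "'a::distrib_lattice set"
  assumes "x \<in> generated_sublattice G"
  shows "x \<in> inf_closure (sup_closure G)"
  using assms
  by induction (auto intro: inf_closure.intros sup_closure.base sup_inf_closure_sup_closure)

text \<open>With \<open>x\<close> a join of meets and \<open>y\<close> a meet of joins,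
  \<open>x <= y\<close> splits into one inequality per joinand of \<open>x\<close> and meetand of
  \<open>y\<close>. As \<open>f\<close> preserves both operations, \<open>f x <= f y\<close> splits
  in the same way.\<close>

lemma generated_sublattice_reflect_le:
  fixes f :: "'a::distrib_lattice \<Rightarrow> 'b::lattice"
  assumes sup: "\<And>x y. f (sup x y) = sup (f x) (f y)"
    and inf: "\<And>x y. f (inf x y) = inf (f x) (f y)"
    and reflect: "\<And>x y. x \<in> inf_closure G \<Longrightarrow> y \<in> sup_closure G \<Longrightarrow> f x \<le> f y \<Longrightarrow> x \<le> y"
    and "x \<in> generated_sublattice G" "y \<in> generated_sublattice G" "f x \<le> f y"
  shows "x \<le> y"
proof -
  have reflect': "x \<le> y"
    if "x \<in> sup_closure (inf_closure G)" "y \<in> sup_closure G" "f x \<le> f y" for x y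
    using that by (induction rule: sup_closure.induct) (auto simp: sup reflect)
  have "y \<in> inf_closure (sup_closure G)"
    using assms(5) by (rule generated_sublattice_subset_inf_sup)
  then show ?thesis
    using assms(6)
    by induction
      (auto simp: inf intro: reflect' generated_sublattice_subset_sup_inf[OF assms(4)])
qed

lemma image_generated_sublattice:
  assumes sup: "\<And>x y. f (sup x y) = sup (f x) (f y)"
    and inf: "\<And>x y. f (inf x y) = inf (f x) (f y)"
  shows "f ` generated_sublattice G = generated_sublattice (f ` G)"
proof (intro equalityI subsetI)
  fix z assume "z \<in> f ` generated_sublattice G"
  then obtain x where "x \<in> generated_sublattice G" and z: "z = f x" by blast
  from this(1) have "f x \<in> generated_sublattice (f ` G)"
    by induction (auto simp: sup inf intro: generated_sublattice.intros)
  with z show "z \<in> generated_sublattice (f ` G)" by simp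
next
  fix z assume "z \<in> generated_sublattice (f ` G)"
  then show "z \<in> f ` generated_sublattice G"
    by induction
      (auto simp flip: sup inf intro!: imageI intro: generated_sublattice.intros)
qed

lemma
  fixes a b :: "'a::{distrib_lattice,bounded_lattice}"
  shows Dia_bot: "Dia bot = (bot :: 'a dblattice)"
  and Dia_sup: "Dia (sup a b) = sup (Dia a) (Dia b)"
  and Box_top: "Box top = (top :: 'a dblattice)"
  and Box_inf: "Box (inf a b) = inf (Box a) (Box b)"
  and Box_sup_le: "Box (sup a b) \<le> sup (Box a) (Dia b)"
  and Box_Dia_le: "inf (Box a) (Dia b) \<le> Dia (inf a b)"
  by (use dbrelations_Box_Dia[where 'a = 'a, unfolded dbrelations_def] in simp_all)

lemma generated_sublattice_Box_Dia:
  "generated_sublattice (range Box \<union> range Dia) =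
     (UNIV :: 'a::{distrib_lattice,bounded_lattice} dblattice set)"
proof -
  let ?S = "generated_sublattice (range Box \<union> range Dia) :: 'a dblattice set"
  \<comment> \<open>\<open>generated_sublattice\<close> does not add bounds, but here they are
    generators: \<open>Dia bot\<close> and \<open>Box top\<close>.\<close>
  have bt: "bot \<in> ?S" "top \<in> ?S"
    by (metis Dia_bot Box_top UnI1 UnI2 generated_sublattice.base rangeI)+
  have "abs_dblattice t \<in> ?S" for t :: "'a dbterm"
    by (induction t)
      (use bt in \<open>auto intro: generated_sublattice.intros
        simp flip: Box.abs_eq Dia.abs_eq bot_dblattice.abs_eq top_dblattice.abs_eq
          sup_dblattice.abs_eq inf_dblattice.abs_eq\<close>)
  then show ?thesis
    by (metis Quotient3_abs_rep[OF Quotient3_dblattice] UNIV_eq_I)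
qed

lemma bounded_lattice_hom_le_iff:
  assumes "bounded_lattice_hom e" "inj e"
  shows "e x \<le> e y \<longleftrightarrow> x \<le> y"
  using assms by (metis bounded_lattice_hom_def inf.absorb_iff1 injD)

lemma dbrelations_powerset:
  fixes e :: "'a::{distrib_lattice,bounded_lattice} \<Rightarrow> 'b::boolean_algebra"
  assumes "bounded_lattice_hom e"
  shows "dbrelations (\<lambda>a. {..e a}) (\<lambda>b. - {..- e b})"
proof -
  \<comment> \<open>The two mixed relations, read elementwise. For the first, an element outside
    \<open>Dia b\<close> lies below \<open>- e b\<close>, which cancels \<open>e b\<close>; the
    second is read contrapositively, and \<open>e a\<close> cancels \<open>- e a\<close>.\<close>
  have "u \<le> e a" if "u \<le> sup (e a) (e b)" "u \<le> - e b" for u a b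
    using inf.boundedI[OF that] by (simp add: inf_sup_distrib2 le_infI1)
  moreover have "u \<le> - e b" if "u \<le> e a" "u \<le> sup (- e a) (- e b)" for u a b
    using inf.boundedI[OF that] by (simp add: inf_sup_distrib1 le_infI2)
  ultimately show ?thesis
    using assms unfolding dbrelations_def bounded_lattice_hom_def by auto
qed

text \<open>
  The sets \<open>B\<close> and \<open>C\<close> of the next two lemmas are the indices of the occurring generators; their
  finiteness and the reverse bounds are never needed.
\<close>

lemma inf_closure_Box_Dia_bounds:
  fixes h :: "'a::{distrib_lattice,bounded_lattice} dblattice \<Rightarrow> 'b::boolean_algebra set"
  assumes h: "bounded_lattice_hom h" "\<And>a. h (Box a) = {..e a}" "\<And>b. h (Dia b) = - {..- e b}"
    and e: "bounded_lattice_hom e"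
    and "x \<in> inf_closure (range Box \<union> range Dia)"
  shows "\<exists>a B. x \<le> Box a \<and> (\<forall>b\<in>B. x \<le> Dia b) \<and>
           {..e a} \<inter> (\<Inter>b\<in>B. - {..- e b}) \<subseteq> h x"
  using assms(5)
proof induction
  case (base x)
  then consider a where "x = Box a" | b where "x = Dia b" by blast
  then show ?case
  proof cases
    case 1
    then show ?thesis by (intro exI[of _ a] exI[of _ "{}"]) (simp add: h)
  next
    case 2
    \<comment> \<open>A lone diamond is paired with the neutral box \<open>Box top\<close>.\<close>
    then show ?thesis by (intro exI[of _ top] exI[of _ "{b}"]) (simp add: h Box_top)
  qed
next
  case (inf x y)
  then obtain a B c C
    where "x \<le> Box a" "\<forall>b\<in>B. x \<le> Dia b" "{..e a} \<inter> (\<Inter>b\<in>B. - {..- e b}) \<subseteq> h x"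
      and "y \<le> Box c" "\<forall>b\<in>C. y \<le> Dia b" "{..e c} \<inter> (\<Inter>b\<in>C. - {..- e b}) \<subseteq> h y"
    by blast
  moreover have "h (inf x y) = h x \<inter> h y" "e (inf a c) = inf (e a) (e c)"
    using h e by (simp_all add: bounded_lattice_hom_def)
  \<comment> \<open>Boxes merge under meets, so one index suffices for them; diamonds do not, so
    their indices are collected in a set. For joins the roles are exchanged.\<close>
  ultimately show ?case
    by (intro exI[of _ "inf a c"] exI[of _ "B \<union> C"])
      (auto simp: le_infI1 le_infI2 Box_inf)
qed

lemma sup_closure_Box_Dia_bounds:
  fixes h :: "'a::{distrib_lattice,bounded_lattice} dblattice \<Rightarrow> 'b::boolean_algebra set"
  assumes h: "bounded_lattice_hom h" "\<And>a. h (Box a) = {..e a}" "\<And>b. h (Dia b) = - {..- e b}"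
    and e: "bounded_lattice_hom e"
    and "y \<in> sup_closure (range Box \<union> range Dia)"
  shows "\<exists>d C. Dia d \<le> y \<and> (\<forall>c\<in>C. Box c \<le> y) \<and>
           h y \<subseteq> - {..- e d} \<union> (\<Union>c\<in>C. {..e c})"
  using assms(5)
proof induction
  case (base y)
  then consider c where "y = Box c" | d where "y = Dia d" by blast
  then show ?case
  proof cases
    case 1
    then show ?thesis by (intro exI[of _ bot] exI[of _ "{c}"]) (simp add: h Dia_bot)
  next
    case 2
    then show ?thesis by (intro exI[of _ d] exI[of _ "{}"]) (simp add: h)
  qed
next
  case (sup x y)
  then obtain a B c C
    where "Dia a \<le> x" "\<forall>b\<in>B. Box b \<le> x" "h x \<subseteq> - {..- e a} \<union> (\<Union>b\<in>B. {..e b})"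
      and "Dia c \<le> y" "\<forall>b\<in>C. Box b \<le> y" "h y \<subseteq> - {..- e c} \<union> (\<Union>b\<in>C. {..e b})"
    by blast
  moreover have "h (sup x y) = h x \<union> h y" "e (sup a c) = sup (e a) (e c)"
    using h e by (simp_all add: bounded_lattice_hom_def)
  ultimately show ?case
    by (intro exI[of _ "sup a c"] exI[of _ "B \<union> C"])
      (auto simp: le_supI1 le_supI2 Dia_sup)
qed

lemma Box_Dia_reflect_le:
  fixes h :: "'a::{distrib_lattice,bounded_lattice} dblattice \<Rightarrow> 'b::boolean_algebra set"
  assumes h: "bounded_lattice_hom h" "\<And>a. h (Box a) = {..e a}" "\<And>b. h (Dia b) = - {..- e b}"
    and e: "bounded_lattice_hom e" "inj e"
    and x: "x \<in> inf_closure (range Box \<union> range Dia)"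
    and y: "y \<in> sup_closure (range Box \<union> range Dia)"
    and le: "h x \<subseteq> h y"
  shows "x \<le> y"
proof -
  obtain a B where x: "x \<le> Box a" "\<forall>b\<in>B. x \<le> Dia b"
    and hx: "{..e a} \<inter> (\<Inter>b\<in>B. - {..- e b}) \<subseteq> h x"
    using inf_closure_Box_Dia_bounds[OF h e(1) x] by blast
  obtain d C where y: "Dia d \<le> y" "\<forall>c\<in>C. Box c \<le> y"
    and hy: "h y \<subseteq> - {..- e d} \<union> (\<Union>c\<in>C. {..e c})"
    using sup_closure_Box_Dia_bounds[OF h e(1) y] by blast
  have Box_mono: "Box p \<le> Box q" and Dia_mono: "Dia p \<le> Dia q" if "p \<le> q" for p q :: 'a
    using that by (metis Box_inf inf.absorb_iff1, metis Dia_sup sup.absorb_iff2)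
  \<comment> \<open>The greatest element below both \<open>e a\<close> and \<open>- e d\<close>.
    What remains to be covered is its down-set, by the down-sets of \<open>- e b\<close> and
    \<open>e c\<close>; one that contains \<open>?u\<close> contains it all.\<close>
  let ?u = "inf (e a) (- e d)"
  have "?u \<notin> - {..- e d}" "?u \<in> {..e a}" by simp_all
  with hx hy le consider b where "b \<in> B" "?u \<le> - e b" | c where "c \<in> C" "?u \<le> e c"
    by blast
  then show ?thesis
  proof cases
    case 1
    \<comment> \<open>Shunting the complements leaves an inequality between values of
      \<open>e\<close>, which reflects order. The chain is
      \<open>x <= inf (Box a) (Dia b) <= Dia (inf a b) <= Dia d <= y\<close>.\<close>
    then have "e (inf a b) \<le> e d"
      using e(1) by (simp add: bounded_lattice_hom_def shunt1 sup_commute)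
    then have "Dia (inf a b) \<le> Dia d"
      by (simp add: bounded_lattice_hom_le_iff[OF e] Dia_mono)
    with x 1 y Box_Dia_le[of a b] show ?thesis by (meson le_infI order_trans)
  next
    case 2
    \<comment> \<open>Likewise, with the chain
      \<open>x <= Box a <= Box (sup c d) <= sup (Box c) (Dia d) <= y\<close>.\<close>
    then have "e a \<le> e (sup c d)"
      using e(1) by (simp add: bounded_lattice_hom_def shunt1 sup_commute)
    then have "Box a \<le> Box (sup c d)"
      by (simp add: bounded_lattice_hom_le_iff[OF e] Box_mono)
    with x 2 y Box_sup_le[of c d] show ?thesis by (meson le_supI order_trans)
  qed
qed

theorem theorem4p13:
  fixes e :: "'a::{distrib_lattice,bounded_lattice} \<Rightarrow> 'b::boolean_algebra"
  assumes "free_boolean_extension e"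
  shows "\<exists>h :: 'a dblattice \<Rightarrow> 'b set.
           bounded_lattice_hom h \<and>
           bij_betw h UNIV
             (generated_sublattice (range (\<lambda>a. {..e a}) \<union> range (\<lambda>b. - {..- e b}))) \<and>
           (\<forall>a. h (Box a) = {..e a}) \<and>
           (\<forall>b. h (Dia b) = - {..- e b})"
proof -
  have e: "bounded_lattice_hom e" "inj e"
    using assms by (auto simp: free_boolean_extension_def)
  obtain h :: "'a dblattice \<Rightarrow> 'b set" where h: "bounded_lattice_hom h"
    "\<And>a. h (Box a) = {..e a}" "\<And>b. h (Dia b) = - {..- e b}"
    using dblattice_universal[OF dbrelations_powerset[OF e(1)]] by blast
  have sup: "h (sup x y) = sup (h x) (h y)" and inf: "h (inf x y) = inf (h x) (h y)" for x y
    using h(1) by (simp_all add: bounded_lattice_hom_def)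
  have "x \<le> y" if "h x \<le> h y" for x y
  proof (rule generated_sublattice_reflect_le[OF sup inf _ _ _ that])
    show "x \<in> generated_sublattice (range Box \<union> range Dia)"
      "y \<in> generated_sublattice (range Box \<union> range Dia)"
      by (simp_all add: generated_sublattice_Box_Dia)
  qed (rule Box_Dia_reflect_le[OF h e])
  then have "inj h"
    by (auto intro!: injI order_antisym)
  \<comment> \<open>The generators exhaust the presented lattice, so the range is the sublattice
    generated by their images.\<close>
  moreover have "range h =
      generated_sublattice (range (\<lambda>a. {..e a}) \<union> range (\<lambda>b. - {..- e b}))"
    using image_generated_sublattice[of h "range Box \<union> range Dia", OF sup inf]
    by (simp add: generated_sublattice_Box_Dia image_Un image_image h)
  ultimately show ?thesis
    using h by (auto simp: bij_betw_def)
qed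

end
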